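(* Let $(\Omega,\Sigma,\mu)$ be a measure space and let $Y$ be a strictly convex Banach space over $\mathbb K\in\{\mathbb R,\mathbb C\}$. Let $u=\sum_{i=1}^{\infty} f_i\otimes y_i\in L_1(\mu)\widehat{\otimes}_\pi Y$ (with $f_i\in L_1(\mu)$, $y_i\in Y$), where the vectors $y_i$ are pairwise non-colinear. Then $$\Big\|\sum_{i=1}^{\infty} f_i\otimes y_i\Big\|=\sum_{i=1}^{\infty}\|f_i\otimes y_i\|$$ if and only if $\mu(\operatorname{supp} f_i\cap\operatorname{supp} f_j)=0$ for all $i\neq j\in\mathbb N$.
   Context: $L_1(\mu)\widehat{\otimes}_\pi Y$ is the projective tensor product, isometrically identified with the space $L_1(\mu,Y)$ of Bochner integrable functions (norm $\int_\Omega\|u(\omega)\|\,d\mu$) via $(f\otimes y)(\omega)=f(\omega)y$; in particular $\|f\otimes y\|=\|f\|\|y\|$. The infinite sum converges in the norm of this space. For $f\in L_1(\mu)$, $\operatorname{supp} f=\{\omega: f(\omega)\neq 0\}$ (defined up to a $\mu$-null set). $Y$ is strictly convex if $\|x+y\|<2$ for all distinct unit vectors $x,y\in Y$. Two vectors are colinear if they are linearly dependent over $\mathbb K$. *)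

theory Defs
  imports "HOL-Analysis.Analysis"
begin

text \<open>
  The scalar field \<open>\<bbbK> \<in> {\<real>, \<complex>}\<close> is a type variable of sort
  \<open>{real_normed_field, euclidean_space}\<close>. Both \<open>real\<close> and \<open>complex\<close> have this sort, and by
  the theorems of Frobenius and Gelfand-Mazur every type of this sort is isometrically
  isomorphic to one of them as a field.

  The class \<open>banach\<close> only provides real scalars, so the scalar multiplication of a Banach space
  over \<open>\<bbbK>\<close> is carried separately. It is required to restrict to \<^term>\<open>scaleR\<close> on the reals.
\<close>

locale banach_space_over = vector_space smul
  for smul :: "'k::{real_normed_field,euclidean_space} \<Rightarrow> 'y::banach \<Rightarrow> 'y" +
  assumes norm_scale: "norm (smul c x) = norm c * norm x"
    and scale_of_real: "smul (of_real r) x = r *\<^sub>R x"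

lemma banach_space_over_real:
  "banach_space_over (scaleR :: real \<Rightarrow> 'y::banach \<Rightarrow> 'y)"
  by unfold_locales (simp_all add: algebra_simps)

lemma banach_space_over_complex:
  "banach_space_over ((*) :: complex \<Rightarrow> complex \<Rightarrow> complex)"
  by unfold_locales (simp_all add: algebra_simps norm_mult scaleR_conv_of_real)

definition strictly_convex :: "'y::real_normed_vector itself \<Rightarrow> bool" where
  "strictly_convex _ \<longleftrightarrow>
     (\<forall>x y :: 'y. norm x = 1 \<longrightarrow> norm y = 1 \<longrightarrow> x \<noteq> y \<longrightarrow> norm (x + y) < 2)"

text \<open>
  Linear dependence of the family \<open>(x, y)\<close>. The library's \<open>dependent {x, y}\<close> speaks about the
  set instead, and is false for \<open>x = y \<noteq> 0\<close>.
\<close>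

definition colinear :: "('k::field \<Rightarrow> 'y::ab_group_add \<Rightarrow> 'y) \<Rightarrow> 'y \<Rightarrow> 'y \<Rightarrow> bool" where
  "colinear smul x y \<longleftrightarrow> (\<exists>a b. (a \<noteq> 0 \<or> b \<noteq> 0) \<and> smul a x + smul b y = 0)"

text \<open>
  The library's \<^const>\<open>integrable\<close> requires a separable codomain, so Bochner integrability into
  an arbitrary Banach space is defined here. Strong measurability guarantees that
  \<open>\<omega> \<mapsto> norm (u \<omega> - s \<omega>)\<close> is a.e. equal to a measurable function for every simple \<open>s\<close>, so that
  the integrals \<open>\<integral>\<^sup>+\<close> below are honest ones (on non-measurable functions \<open>\<integral>\<^sup>+\<close> is a lower integral).
\<close>

definition strongly_measurable :: "'a measure \<Rightarrow> ('a \<Rightarrow> 'y::real_normed_vector) \<Rightarrow> bool" where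
  "strongly_measurable M u \<longleftrightarrow>
     (\<exists>s. (\<forall>n. simple_function M (s n)) \<and> (AE \<omega> in M. (\<lambda>n. s n \<omega>) \<longlonglongrightarrow> u \<omega>))"

definition bochner_integrable :: "'a measure \<Rightarrow> ('a \<Rightarrow> 'y::real_normed_vector) \<Rightarrow> bool" where
  "bochner_integrable M u \<longleftrightarrow> strongly_measurable M u \<and>
     (\<exists>s. (\<forall>n. Bochner_Integration.simple_bochner_integrable M (s n)) \<and>
          (\<lambda>n. \<integral>\<^sup>+\<omega>. norm (u \<omega> - s n \<omega>) \<partial>M) \<longlonglongrightarrow> 0)"

text \<open>
  The projective tensor product of \<open>L\<^sub>1(\<mu>)\<close> and \<open>Y\<close> is taken to be \<open>L\<^sub>1(\<mu>, Y)\<close>, whose elements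
  are represented by Bochner integrable functions. The norm takes values in \<^typ>\<open>ennreal\<close>, so
  that the sum of the norms of a series of elements always exists in \<open>[0, \<infinity>]\<close>.
\<close>

definition L1_norm :: "'a measure \<Rightarrow> ('a \<Rightarrow> 'y::real_normed_vector) \<Rightarrow> ennreal" where
  "L1_norm M u = (\<integral>\<^sup>+\<omega>. norm (u \<omega>) \<partial>M)"

definition tensor :: "('k \<Rightarrow> 'y \<Rightarrow> 'y) \<Rightarrow> ('a \<Rightarrow> 'k) \<Rightarrow> 'y \<Rightarrow> 'a \<Rightarrow> 'y" where
  "tensor smul f y = (\<lambda>\<omega>. smul (f \<omega>) y)"

definition L1_sums ::
    "'a measure \<Rightarrow> (nat \<Rightarrow> 'a \<Rightarrow> 'y::real_normed_vector) \<Rightarrow> ('a \<Rightarrow> 'y) \<Rightarrow> bool" where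
  "L1_sums M g u \<longleftrightarrow> (\<lambda>n. L1_norm M (\<lambda>\<omega>. u \<omega> - (\<Sum>i<n. g i \<omega>))) \<longlonglongrightarrow> 0"

definition supp :: "'a measure \<Rightarrow> ('a \<Rightarrow> 'k::zero) \<Rightarrow> 'a set" where
  "supp M f = {\<omega> \<in> space M. f \<omega> \<noteq> 0}"

context banach_space_over
begin

lemma L1_norm_tensor:
  assumes "integrable M f"
  shows "L1_norm M (tensor smul f y) = L1_norm M f * norm y"
  using assms unfolding L1_norm_def tensor_def
  by (simp add: norm_scale ennreal_mult nn_integral_multc)

lemma bochner_integrable_tensor:
  assumes "integrable M f"
  shows "bochner_integrable M (tensor smul f y)"
proof -
  have lim: "(\<lambda>n. smul (s n) y) \<longlonglongrightarrow> smul c y" if "s \<longlonglongrightarrow> c" for s c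
  proof (rule LIM_zero_cancel, rule tendsto_norm_zero_cancel)
    have "(\<lambda>n. norm (s n - c) * norm y) \<longlonglongrightarrow> 0"
      using that by (intro tendsto_mult_left_zero tendsto_norm_zero LIM_zero)
    then show "(\<lambda>n. norm (smul (s n) y - smul c y)) \<longlonglongrightarrow> 0"
      by (simp add: norm_scale flip: scale_left_diff_distrib)
  qed
  from assms obtain s
    where f: "f \<in> borel_measurable M"
      and s: "\<And>i. Bochner_Integration.simple_bochner_integrable M (s i)"
      and s0: "(\<lambda>i. \<integral>\<^sup>+x. norm (f x - s i x) \<partial>M) \<longlonglongrightarrow> 0"
    by (auto elim!: integrable.cases has_bochner_integral.cases)
  obtain t where t: "\<And>i. simple_function M (t i)"
    "\<And>x. x \<in> space M \<Longrightarrow> (\<lambda>i. t i x) \<longlonglongrightarrow> f x"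
    using borel_measurable_implies_sequence_metric[OF f, of 0] by auto
  have "strongly_measurable M (tensor smul f y)"
    unfolding strongly_measurable_def tensor_def
    using t by (intro exI[of _ "\<lambda>i x. smul (t i x) y"] conjI allI AE_I2 lim)
      (auto intro: simple_function_compose1[where g = "\<lambda>c. smul c y"])
  moreover have "Bochner_Integration.simple_bochner_integrable M (\<lambda>x. smul (s i x) y)" for i
    by (rule simple_bochner_integrable_compose2[OF _ s s, of "\<lambda>c _. smul c y"]) simp
  moreover have "(\<lambda>i. \<integral>\<^sup>+x. norm (tensor smul f y x - smul (s i x) y) \<partial>M) \<longlonglongrightarrow> 0"
  proof -
    have [measurable]: "s i \<in> borel_measurable M" for i
      using s[of i] by (auto elim!: simple_bochner_integrable.cases
          intro: borel_measurable_simple_function)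
    have "(\<lambda>i. (\<integral>\<^sup>+x. norm (f x - s i x) \<partial>M) * ennreal (norm y)) \<longlonglongrightarrow> 0 * ennreal (norm y)"
      by (intro tendsto_mult_ennreal s0) auto
    then show ?thesis
      using f by (simp add: tensor_def norm_scale ennreal_mult nn_integral_multc
          flip: scale_left_diff_distrib)
  qed
  ultimately show ?thesis
    unfolding bochner_integrable_def
    by (intro conjI exI[of _ "\<lambda>i x. smul (s i x) y"] allI)
qed

end

end

theory Submission
  imports Defs
begin

text \<open>
  If the supports are disjoint, the norm is additive on the partial sums pointwise a.e., and one
  passes to the limit. Conversely, grouping the terms \<open>i\<close> and \<open>j\<close> in the triangle inequality shows
  that equality for the whole series forces
  \<open>\<parallel>f\<^sub>i \<otimes> y\<^sub>i + f\<^sub>j \<otimes> y\<^sub>j\<parallel> = \<parallel>f\<^sub>i \<otimes> y\<^sub>i\<parallel> + \<parallel>f\<^sub>j \<otimes> y\<^sub>j\<parallel>\<close>, and since all quantities are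
  finite this equality holds pointwise a.e. in \<open>Y\<close>. By strict convexity, at a point
  where \<open>f\<^sub>i\<close> and \<open>f\<^sub>j\<close> are both nonzero \<open>y\<^sub>i\<close> and \<open>y\<^sub>j\<close> would be colinear.
\<close>

section \<open>Pointwise additivity of the norm\<close>

text \<open>Extends strict convexity from unit vectors to arbitrary ones. If \<open>a\<close> is the
  shorter vector, \<open>a + b\<close> is \<open>norm a *\<^sub>R (sgn a + sgn b)\<close> plus a
  nonnegative multiple of \<open>sgn b\<close>. Distinct directions make the first piece strictly
  shorter than \<open>2 * norm a\<close>, so additivity fails.\<close>

lemma strictly_convex_sgn_eq:
  fixes x y :: "'y::real_normed_vector"
  assumes "strictly_convex TYPE('y)"
    and "norm (x + y) = norm x + norm y" and "x \<noteq> 0" and "y \<noteq> 0"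
  shows "sgn x = sgn y"
proof -
  have *: "sgn a = sgn b"
    if eq: "norm (a + b) = norm a + norm b" and "a \<noteq> 0" and "b \<noteq> 0" and le: "norm a \<le> norm b"
    for a b :: 'y
  proof (rule ccontr)
    assume "sgn a \<noteq> sgn b"
    then have "norm (sgn a + sgn b) < 2"
      using assms(1) that unfolding strictly_convex_def by (simp add: norm_sgn)
    then have lt: "norm a * norm (sgn a + sgn b) < norm a * 2"
      using \<open>a \<noteq> 0\<close> by (intro mult_strict_left_mono) auto
    have "a + b = norm a *\<^sub>R (sgn a + sgn b) + (norm b - norm a) *\<^sub>R sgn b"
      using that by (simp add: sgn_div_norm algebra_simps)
    then have "norm (a + b) \<le> norm (norm a *\<^sub>R (sgn a + sgn b)) + norm ((norm b - norm a) *\<^sub>R sgn b)"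
      by (metis norm_triangle_ineq)
    also have "\<dots> = norm a * norm (sgn a + sgn b) + (norm b - norm a)"
      using le \<open>b \<noteq> 0\<close> by (simp add: norm_sgn)
    finally show False
      using lt eq by simp
  qed
  show ?thesis
  proof (cases "norm x \<le> norm y")
    case True
    then show ?thesis using * assms by blast
  next
    case False
    then show ?thesis using *[of y x] assms by (simp add: add.commute)
  qed
qed

text \<open>At most one summand is nonzero, and both sides reduce to its norm.\<close>

lemma norm_sum_eq_sum_norm_if_disjoint:
  fixes x :: "'i \<Rightarrow> 'y::real_normed_vector"
  assumes "finite A" and "\<And>i j. i \<in> A \<Longrightarrow> j \<in> A \<Longrightarrow> i \<noteq> j \<Longrightarrow> x i = 0 \<or> x j = 0"
  shows "norm (\<Sum>i\<in>A. x i) = (\<Sum>i\<in>A. norm (x i))"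
  using assms
proof (induction A rule: finite_induct)
  case empty
  then show ?case by simp
next
  case (insert a A)
  show ?case
  proof (cases "x a = 0")
    case True
    then show ?thesis using insert by simp
  next
    case False
    then have "\<forall>i\<in>A. x i = 0"
      using insert by (metis insert_iff)
    then show ?thesis using insert by simp
  qed
qed

section \<open>Strongly measurable functions\<close>

lemma strongly_measurable_add:
  assumes "strongly_measurable M u" and "strongly_measurable M v"
  shows "strongly_measurable M (\<lambda>\<omega>. u \<omega> + v \<omega>)"
proof -
  obtain s t where "\<And>n. simple_function M (s n)" "AE \<omega> in M. (\<lambda>n. s n \<omega>) \<longlonglongrightarrow> u \<omega>"
    "\<And>n. simple_function M (t n)" "AE \<omega> in M. (\<lambda>n. t n \<omega>) \<longlonglongrightarrow> v \<omega>"
    using assms unfolding strongly_measurable_def by auto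
  then show ?thesis
    unfolding strongly_measurable_def
    by (intro exI[of _ "\<lambda>n \<omega>. s n \<omega> + t n \<omega>"])
       (auto intro: simple_function_compose2 tendsto_add)
qed

lemma strongly_measurable_uminus:
  assumes "strongly_measurable M u"
  shows "strongly_measurable M (\<lambda>\<omega>. - u \<omega>)"
proof -
  obtain s where "\<And>n. simple_function M (s n)" "AE \<omega> in M. (\<lambda>n. s n \<omega>) \<longlonglongrightarrow> u \<omega>"
    using assms unfolding strongly_measurable_def by auto
  then show ?thesis
    unfolding strongly_measurable_def
    by (intro exI[of _ "\<lambda>n \<omega>. - s n \<omega>"])
       (auto intro: simple_function_compose1 tendsto_minus)
qed

lemma strongly_measurable_diff:
  assumes "strongly_measurable M u" and "strongly_measurable M v"
  shows "strongly_measurable M (\<lambda>\<omega>. u \<omega> - v \<omega>)"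
  using strongly_measurable_add[OF assms(1) strongly_measurable_uminus[OF assms(2)]] by simp

lemma strongly_measurable_sum:
  assumes "finite A" and "\<And>i. i \<in> A \<Longrightarrow> strongly_measurable M (g i)"
  shows "strongly_measurable M (\<lambda>\<omega>. \<Sum>i\<in>A. g i \<omega>)"
  using assms
proof (induction A rule: finite_induct)
  case empty
  show ?case
    by (auto simp: strongly_measurable_def intro!: exI[of _ "\<lambda>_ _. 0"])
next
  case (insert a A)
  then show ?case by (auto intro: strongly_measurable_add)
qed

text \<open>The approximation of \<open>u\<close> may fail on a null set, so the norm of
  \<open>u\<close> itself may be non-measurable. The liminf of the norms of the simple functions is
  measurable and agrees with it wherever they converge. The integration rules are applied to this
  representative.\<close>

lemma strongly_measurable_norm_AE_eq:
  assumes "strongly_measurable M u"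
  obtains h :: "'a \<Rightarrow> ennreal"
  where "h \<in> borel_measurable M" and "AE \<omega> in M. ennreal (norm (u \<omega>)) = h \<omega>"
proof -
  obtain s where s: "\<And>n. simple_function M (s n)" and lim: "AE \<omega> in M. (\<lambda>n. s n \<omega>) \<longlonglongrightarrow> u \<omega>"
    using assms unfolding strongly_measurable_def by auto
  have meas: "(\<lambda>\<omega>. ennreal (norm (s n \<omega>))) \<in> borel_measurable M" for n
    using simple_function_compose1[OF s[of n], of "\<lambda>x. ennreal (norm x)"]
    by (rule borel_measurable_simple_function)
  show ?thesis
  proof
    show "(\<lambda>\<omega>. liminf (\<lambda>n. ennreal (norm (s n \<omega>)))) \<in> borel_measurable M"
      using meas by (rule borel_measurable_liminf)
    show "AE \<omega> in M. ennreal (norm (u \<omega>)) = liminf (\<lambda>n. ennreal (norm (s n \<omega>)))"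
      using lim
    proof eventually_elim
      case (elim \<omega>)
      then have "(\<lambda>n. ennreal (norm (s n \<omega>))) \<longlonglongrightarrow> ennreal (norm (u \<omega>))"
        by (intro tendsto_ennrealI tendsto_norm)
      then show ?case
        by (intro lim_imp_Liminf[symmetric]) auto
    qed
  qed
qed

section \<open>The triangle inequality for \<open>L1_norm\<close> and its equality case\<close>

lemma nn_integral_norm_add:
  assumes "strongly_measurable M u" and "strongly_measurable M v"
  shows "(\<integral>\<^sup>+\<omega>. ennreal (norm (u \<omega>)) + ennreal (norm (v \<omega>)) \<partial>M) = L1_norm M u + L1_norm M v"
proof -
  obtain h where h: "h \<in> borel_measurable M" "AE \<omega> in M. ennreal (norm (u \<omega>)) = h \<omega>"
    using strongly_measurable_norm_AE_eq[OF assms(1)] .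
  obtain k where k: "k \<in> borel_measurable M" "AE \<omega> in M. ennreal (norm (v \<omega>)) = k \<omega>"
    using strongly_measurable_norm_AE_eq[OF assms(2)] .
  have "(\<integral>\<^sup>+\<omega>. ennreal (norm (u \<omega>)) + ennreal (norm (v \<omega>)) \<partial>M) = (\<integral>\<^sup>+\<omega>. h \<omega> + k \<omega> \<partial>M)"
    using h(2) k(2) by (intro nn_integral_cong_AE) auto
  also have "\<dots> = (\<integral>\<^sup>+\<omega>. h \<omega> \<partial>M) + (\<integral>\<^sup>+\<omega>. k \<omega> \<partial>M)"
    by (rule nn_integral_add[OF h(1) k(1)])
  also have "\<dots> = L1_norm M u + L1_norm M v"
    unfolding L1_norm_def using h(2) k(2) by (simp cong: nn_integral_cong_AE)
  finally show ?thesis .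
qed

lemma L1_norm_triangle:
  assumes "strongly_measurable M u" and "strongly_measurable M v"
  shows "L1_norm M (\<lambda>\<omega>. u \<omega> + v \<omega>) \<le> L1_norm M u + L1_norm M v"
  unfolding nn_integral_norm_add[OF assms, symmetric] unfolding L1_norm_def
  by (intro nn_integral_mono) (simp flip: ennreal_plus add: norm_triangle_ineq)

lemma L1_norm_uminus: "L1_norm M (\<lambda>\<omega>. - u \<omega>) = L1_norm M u"
  by (simp add: L1_norm_def)

lemma L1_norm_sum_le:
  assumes "finite A" and "\<And>i. i \<in> A \<Longrightarrow> strongly_measurable M (g i)"
  shows "L1_norm M (\<lambda>\<omega>. \<Sum>i\<in>A. g i \<omega>) \<le> (\<Sum>i\<in>A. L1_norm M (g i))"
  using assms
proof (induction A rule: finite_induct)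
  case empty
  show ?case by (simp add: L1_norm_def)
next
  case (insert a A)
  have "L1_norm M (\<lambda>\<omega>. g a \<omega> + (\<Sum>i\<in>A. g i \<omega>)) \<le> L1_norm M (g a) + L1_norm M (\<lambda>\<omega>. \<Sum>i\<in>A. g i \<omega>)"
    using insert by (intro L1_norm_triangle strongly_measurable_sum) auto
  also have "\<dots> \<le> L1_norm M (g a) + (\<Sum>i\<in>A. L1_norm M (g i))"
    using insert by (intro add_left_mono) auto
  finally show ?case using insert by simp
qed

text \<open>The defect in the pointwise triangle inequality is nonnegative and has integral zero,
  hence vanishes almost everywhere. Finiteness allows the integrals to be subtracted. The argument
  runs on measurable representatives \<open>h\<close>, \<open>k\<close>, \<open>l\<close> of the
  three norms.\<close>

lemma L1_norm_add_eq_AE: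
  assumes u: "strongly_measurable M u" and v: "strongly_measurable M v"
    and fin: "L1_norm M u < \<infinity>" "L1_norm M v < \<infinity>"
    and le: "L1_norm M u + L1_norm M v \<le> L1_norm M (\<lambda>\<omega>. u \<omega> + v \<omega>)"
  shows "AE \<omega> in M. norm (u \<omega> + v \<omega>) = norm (u \<omega>) + norm (v \<omega>)"
proof -
  obtain h where h: "h \<in> borel_measurable M" "AE \<omega> in M. ennreal (norm (u \<omega>)) = h \<omega>"
    using strongly_measurable_norm_AE_eq[OF u] .
  obtain k where k: "k \<in> borel_measurable M" "AE \<omega> in M. ennreal (norm (v \<omega>)) = k \<omega>"
    using strongly_measurable_norm_AE_eq[OF v] .
  obtain l where l: "l \<in> borel_measurable M" "AE \<omega> in M. ennreal (norm (u \<omega> + v \<omega>)) = l \<omega>"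
    using strongly_measurable_norm_AE_eq[OF strongly_measurable_add[OF u v]] .
  have l_le: "AE \<omega> in M. l \<omega> \<le> h \<omega> + k \<omega>"
    using h(2) k(2) l(2)
  proof eventually_elim
    case (elim \<omega>)
    have "ennreal (norm (u \<omega> + v \<omega>)) \<le> ennreal (norm (u \<omega>)) + ennreal (norm (v \<omega>))"
      by (simp add: norm_triangle_ineq flip: ennreal_plus)
    then show ?case
      by (simp only: elim)
  qed
  have int_hk: "(\<integral>\<^sup>+\<omega>. h \<omega> + k \<omega> \<partial>M) = L1_norm M u + L1_norm M v"
    unfolding nn_integral_norm_add[OF u v, symmetric]
    using h(2) k(2) by (intro nn_integral_cong_AE) auto
  have int_l: "(\<integral>\<^sup>+\<omega>. l \<omega> \<partial>M) = L1_norm M (\<lambda>\<omega>. u \<omega> + v \<omega>)"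
    unfolding L1_norm_def using l(2) by (intro nn_integral_cong_AE) auto
  have int_eq: "(\<integral>\<^sup>+\<omega>. l \<omega> \<partial>M) = (\<integral>\<^sup>+\<omega>. h \<omega> + k \<omega> \<partial>M)"
    unfolding int_hk int_l using le L1_norm_triangle[OF u v] by (rule antisym[rotated])
  have fin_hk: "(\<integral>\<^sup>+\<omega>. h \<omega> + k \<omega> \<partial>M) \<noteq> \<infinity>"
    unfolding int_hk using fin by (simp add: less_top)
  have "(\<integral>\<^sup>+\<omega>. (h \<omega> + k \<omega>) - l \<omega> \<partial>M) = (\<integral>\<^sup>+\<omega>. h \<omega> + k \<omega> \<partial>M) - (\<integral>\<^sup>+\<omega>. l \<omega> \<partial>M)"
    using h(1) k(1) l(1) l_le fin_hk by (intro nn_integral_diff) (auto simp: int_eq)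
  also have "\<dots> = 0"
    using fin_hk by (simp add: int_eq)
  finally have "AE \<omega> in M. (h \<omega> + k \<omega>) - l \<omega> = 0"
    using h(1) k(1) l(1) by (subst (asm) nn_integral_0_iff_AE) auto
  \<comment> \<open>Subtraction on \<open>ennreal\<close> is truncated, so a zero difference yields
    only this inequality; the pointwise triangle inequality supplies the other one at the
    end.\<close>
  then have "AE \<omega> in M. h \<omega> + k \<omega> \<le> l \<omega>"
    by eventually_elim (metis ennreal_minus_le_iff add_0_right order_refl)
  then show ?thesis
    using h(2) k(2) l(2)
  proof eventually_elim
    case (elim \<omega>)
    have "ennreal (norm (u \<omega>) + norm (v \<omega>)) \<le> ennreal (norm (u \<omega> + v \<omega>))"
      unfolding ennreal_plus[OF norm_ge_zero norm_ge_zero] elim(2-4) by (rule elim(1))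
    then have "norm (u \<omega>) + norm (v \<omega>) \<le> norm (u \<omega> + v \<omega>)"
      by (simp flip: ennreal_plus)
    then show ?case
      using norm_triangle_ineq[of "u \<omega>" "v \<omega>"] by linarith
  qed
qed

section \<open>Series converging in the \<open>L1_norm\<close>\<close>

context
  fixes M :: "'a measure" and g :: "nat \<Rightarrow> 'a \<Rightarrow> 'y::real_normed_vector" and u :: "'a \<Rightarrow> 'y"
  assumes u: "strongly_measurable M u"
    and g: "\<And>i. strongly_measurable M (g i)"
    and sums: "L1_sums M g u"
begin

lemma L1_norm_sums_le:
  "L1_norm M u \<le> L1_norm M (\<lambda>\<omega>. u \<omega> - (\<Sum>i<n. g i \<omega>)) + L1_norm M (\<lambda>\<omega>. \<Sum>i<n. g i \<omega>)"
proof -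
  have S: "strongly_measurable M (\<lambda>\<omega>. \<Sum>i<n. g i \<omega>)"
    by (intro strongly_measurable_sum g) auto
  show ?thesis
    using L1_norm_triangle[OF strongly_measurable_diff[OF u S] S] by simp
qed

text \<open>Continuity of the norm: by the triangle inequality each partial sum has norm within the
  remainder \<open>?d n\<close> of \<open>L1_norm M u\<close>, and the remainder tends to 0.\<close>

lemma L1_norm_partial_sum_tendsto: "(\<lambda>n. L1_norm M (\<lambda>\<omega>. \<Sum>i<n. g i \<omega>)) \<longlonglongrightarrow> L1_norm M u"
proof (rule tendsto_sandwich)
  let ?d = "\<lambda>n. L1_norm M (\<lambda>\<omega>. u \<omega> - (\<Sum>i<n. g i \<omega>))"
  have d: "?d \<longlonglongrightarrow> 0"
    using sums unfolding L1_sums_def .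
  have S: "strongly_measurable M (\<lambda>\<omega>. \<Sum>i<n. g i \<omega>)" for n
    by (intro strongly_measurable_sum g) auto
  have "L1_norm M (\<lambda>\<omega>. \<Sum>i<n. g i \<omega>) \<le> L1_norm M u + ?d n" for n
    using L1_norm_triangle[OF u strongly_measurable_uminus[OF strongly_measurable_diff[OF u S]]]
    unfolding L1_norm_uminus by simp
  then show "\<forall>\<^sub>F n in sequentially. L1_norm M (\<lambda>\<omega>. \<Sum>i<n. g i \<omega>) \<le> L1_norm M u + ?d n"
    by simp
  \<comment> \<open>In \<open>ennreal\<close>, \<open>top - top\<close> is \<open>top\<close>;
    moving \<open>?d n\<close> across the inequality is safe once it is finite.\<close>
  have "\<forall>\<^sub>F n in sequentially. ?d n < top"
    using d by (rule order_tendstoD) simp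
  then show "\<forall>\<^sub>F n in sequentially. L1_norm M u - ?d n \<le> L1_norm M (\<lambda>\<omega>. \<Sum>i<n. g i \<omega>)"
    by eventually_elim (auto simp: ennreal_minus_le_iff L1_norm_sums_le)
  show "(\<lambda>n. L1_norm M u - ?d n) \<longlonglongrightarrow> L1_norm M u"
    using tendsto_diff_ennreal_general[OF tendsto_const d] by simp
  show "(\<lambda>n. L1_norm M u + ?d n) \<longlonglongrightarrow> L1_norm M u"
    using tendsto_add[OF tendsto_const d] by simp
qed

text \<open>Some partial sum lies at finite distance from \<open>u\<close> and has finite norm
  itself. This is what later permits cancelling \<open>L1_norm M u\<close> in
  \<open>ennreal\<close>.\<close>

lemma L1_norm_sums_finite:
  assumes "\<And>i. L1_norm M (g i) < \<infinity>"
  shows "L1_norm M u < \<infinity>"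
proof -
  have "\<forall>\<^sub>F n in sequentially. L1_norm M (\<lambda>\<omega>. u \<omega> - (\<Sum>i<n. g i \<omega>)) < \<infinity>"
    using sums unfolding L1_sums_def by (rule order_tendstoD) simp
  then obtain n where "L1_norm M (\<lambda>\<omega>. u \<omega> - (\<Sum>i<n. g i \<omega>)) < \<infinity>"
    by (auto simp: eventually_sequentially)
  moreover have "L1_norm M (\<lambda>\<omega>. \<Sum>i<n. g i \<omega>) < \<infinity>"
    using assms by (intro le_less_trans[OF L1_norm_sum_le[OF _ g]]) auto
  ultimately show ?thesis
    by (intro le_less_trans[OF L1_norm_sums_le[of n]]) simp
qed

text \<open>Almost everywhere at most one term is nonzero, so the norm is additive on every partial
  sum; the partial sums of the norms then converge to \<open>L1_norm M u\<close>.\<close>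

lemma L1_norm_sums_eq_if_disjoint:
  assumes "AE \<omega> in M. \<forall>i j. i \<noteq> j \<longrightarrow> g i \<omega> = 0 \<or> g j \<omega> = 0"
  shows "L1_norm M u = (\<Sum>i. L1_norm M (g i))"
proof -
  have "L1_norm M (\<lambda>\<omega>. \<Sum>i<n. g i \<omega>) = (\<Sum>i<n. L1_norm M (g i))" for n
  proof (induction n)
    case 0
    show ?case by (simp add: L1_norm_def)
  next
    case (Suc n)
    \<comment> \<open>Both sums must become sums of norms before the last term is split off, which
      is why \<open>sum.lessThan_Suc\<close> is withheld in the first simplification.\<close>
    have "L1_norm M (\<lambda>\<omega>. \<Sum>i<Suc n. g i \<omega>)
        = (\<integral>\<^sup>+\<omega>. ennreal (norm (\<Sum>i<n. g i \<omega>)) + ennreal (norm (g n \<omega>)) \<partial>M)"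
      unfolding L1_norm_def using assms
      by (intro nn_integral_cong_AE, eventually_elim)
         (simp add: norm_sum_eq_sum_norm_if_disjoint del: sum.lessThan_Suc,
          simp add: sum_nonneg)
    also have "\<dots> = L1_norm M (\<lambda>\<omega>. \<Sum>i<n. g i \<omega>) + L1_norm M (g n)"
      by (intro nn_integral_norm_add strongly_measurable_sum g) auto
    finally show ?case
      using Suc by simp
  qed
  then have "(\<lambda>n. \<Sum>i<n. L1_norm M (g i)) \<longlonglongrightarrow> L1_norm M u"
    using L1_norm_partial_sum_tendsto by simp
  then show ?thesis
    by (intro sums_unique) (simp add: sums_def)
qed

text \<open>Keeping terms \<open>i\<close> and \<open>j\<close> together bounds a partial sum by
  \<open>?a\<close> plus the norms of the other terms. Adding \<open>?b\<close> on both sides,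
  instead of subtracting in \<open>ennreal\<close>, completes those norms to a partial sum of the
  full series, which is at most \<open>L1_norm M u\<close>. In the limit \<open>L1_norm M u\<close>
  occurs on both sides and, being finite, cancels.\<close>

lemma L1_norm_sums_eq_imp_norm_add_eq:
  assumes fin: "\<And>i. L1_norm M (g i) < \<infinity>"
    and eq: "L1_norm M u = (\<Sum>i. L1_norm M (g i))"
    and ij: "i \<noteq> j"
  shows "AE \<omega> in M. norm (g i \<omega> + g j \<omega>) = norm (g i \<omega>) + norm (g j \<omega>)"
proof (rule L1_norm_add_eq_AE[OF g g fin fin])
  let ?a = "L1_norm M (\<lambda>\<omega>. g i \<omega> + g j \<omega>)" and ?b = "L1_norm M (g i) + L1_norm M (g j)"
  have "L1_norm M (\<lambda>\<omega>. \<Sum>k<n. g k \<omega>) + ?b \<le> ?a + L1_norm M u" if n: "n > max i j" for n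
  proof -
    let ?R = "{..<n} - {i, j}"
    \<comment> \<open>Polymorphic in \<open>F\<close>: it splits the sum of the vectors
      \<open>g k \<omega>\<close> as well as the sum of their norms in
      \<open>ennreal\<close>.\<close>
    have split: "(\<Sum>k<n. F k) = (F i + F j) + (\<Sum>k\<in>?R. F k)" for F :: "nat \<Rightarrow> 'b::comm_monoid_add"
      using sum.subset_diff[of "{i, j}" "{..<n}" F] n ij by (simp add: add.commute)
    have "L1_norm M (\<lambda>\<omega>. \<Sum>k<n. g k \<omega>) \<le> ?a + L1_norm M (\<lambda>\<omega>. \<Sum>k\<in>?R. g k \<omega>)"
      unfolding split
      by (intro L1_norm_triangle strongly_measurable_add strongly_measurable_sum g) auto
    also have "\<dots> \<le> ?a + (\<Sum>k\<in>?R. L1_norm M (g k))"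
      by (intro add_left_mono L1_norm_sum_le g) auto
    finally have "L1_norm M (\<lambda>\<omega>. \<Sum>k<n. g k \<omega>) + ?b \<le> ?a + (\<Sum>k\<in>?R. L1_norm M (g k)) + ?b"
      by (rule add_right_mono)
    also have "\<dots> = ?a + (\<Sum>k<n. L1_norm M (g k))"
      unfolding split by (simp add: ac_simps)
    also have "\<dots> \<le> ?a + L1_norm M u"
      unfolding eq by (intro add_left_mono sum_le_suminf) auto
    finally show ?thesis .
  qed
  then have "\<forall>\<^sub>F n in sequentially. L1_norm M (\<lambda>\<omega>. \<Sum>k<n. g k \<omega>) + ?b \<le> ?a + L1_norm M u"
    using eventually_gt_at_top[of "max i j"] by (rule eventually_mono[rotated])
  moreover have "(\<lambda>n. L1_norm M (\<lambda>\<omega>. \<Sum>k<n. g k \<omega>) + ?b) \<longlonglongrightarrow> L1_norm M u + ?b"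
    by (intro tendsto_add L1_norm_partial_sum_tendsto tendsto_const)
  ultimately have "L1_norm M u + ?b \<le> ?a + L1_norm M u"
    by (intro tendsto_upperbound[OF _ _ sequentially_bot])
  then have "L1_norm M u + ?b \<le> L1_norm M u + ?a"
    unfolding add.commute[of ?a] .
  then show "?b \<le> ?a"
    using L1_norm_sums_finite[OF fin] by (auto simp: ennreal_add_left_cancel_le)
qed

end

section \<open>Colinearity and null intersections of supports\<close>

text \<open>By strict convexity the two scaled vectors have the same normalization, and equating the
  normalizations is a nontrivial linear relation between \<open>x\<close> and
  \<open>y\<close>.\<close>

lemma (in banach_space_over) smul_norm_add_eq_imp_colinear:
  fixes a b :: 'k and x y :: 'y
  assumes "strictly_convex TYPE('y)"
    and "norm (smul a x + smul b y) = norm (smul a x) + norm (smul b y)"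
    and "a \<noteq> 0" "b \<noteq> 0" "x \<noteq> 0" "y \<noteq> 0"
  shows "colinear smul x y"
proof -
  \<comment> \<open>The normalizing factors are real; \<open>of_real\<close> embeds them in the
    scalar field so that they merge with \<open>a\<close> and \<open>b\<close> into the coefficients
    of the relation.\<close>
  define r s where "r = inverse (norm (smul a x))" and "s = inverse (norm (smul b y))"
  have "sgn (smul a x) = sgn (smul b y)"
    using assms by (intro strictly_convex_sgn_eq) auto
  then have "smul (of_real r) (smul a x) = smul (of_real s) (smul b y)"
    unfolding scale_of_real r_def s_def by (simp only: sgn_div_norm)
  then have "smul (of_real r * a) x + smul (- (of_real s * b)) y = 0"
    by (simp only: scale_scale scale_minus_left right_minus)
  moreover have "of_real r * a \<noteq> 0"
    using assms by (simp add: r_def)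
  ultimately show ?thesis
    unfolding colinear_def
    by (intro exI[of _ "of_real r * a"] exI[of _ "- (of_real s * b)"] conjI disjI1)
qed

text \<open>A zero vector with coefficient 1 already gives a nontrivial relation.\<close>

lemma (in banach_space_over) not_colinear_nonzero:
  assumes "\<not> colinear smul x y"
  shows "x \<noteq> 0" and "y \<noteq> 0"
proof -
  have "colinear smul 0 y"
    unfolding colinear_def by (intro exI[of _ 1] exI[of _ 0]) simp
  moreover have "colinear smul x 0"
    unfolding colinear_def by (intro exI[of _ 0] exI[of _ 1]) simp
  ultimately show "x \<noteq> 0" and "y \<noteq> 0"
    using assms by auto
qed

text \<open>\<open>emeasure\<close> is 0 by default on non-measurable sets; measurability of
  \<open>f\<close> and \<open>g\<close> puts the intersection into \<open>sets M\<close>, so that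
  value 0 really means a null set.\<close>

lemma emeasure_supp_inter_eq_0_iff:
  fixes f g :: "'a \<Rightarrow> 'k::{real_normed_field,euclidean_space}"
  assumes [measurable]: "f \<in> borel_measurable M" "g \<in> borel_measurable M"
  shows "emeasure M (supp M f \<inter> supp M g) = 0 \<longleftrightarrow> (AE \<omega> in M. f \<omega> = 0 \<or> g \<omega> = 0)"
proof -
  have "supp M f \<inter> supp M g = {\<omega> \<in> space M. \<not> (f \<omega> = 0 \<or> g \<omega> = 0)}"
    by (auto simp: supp_def)
  then show ?thesis
    by (subst AE_iff_measurable[of "supp M f \<inter> supp M g"]) auto
qed

theorem proposition3p1:
  fixes M :: "'a measure"
    and smul :: "'k::{real_normed_field,euclidean_space} \<Rightarrow> 'y::banach \<Rightarrow> 'y"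
    and f :: "nat \<Rightarrow> 'a \<Rightarrow> 'k"
    and y :: "nat \<Rightarrow> 'y"
    and u :: "'a \<Rightarrow> 'y"
  assumes "banach_space_over smul"
    and "strictly_convex TYPE('y)"
    and "\<And>i. integrable M (f i)"
    and "\<And>i j. i \<noteq> j \<Longrightarrow> \<not> colinear smul (y i) (y j)"
    and "bochner_integrable M u"
    and "L1_sums M (\<lambda>i. tensor smul (f i) (y i)) u"
  shows "L1_norm M u = (\<Sum>i. L1_norm M (tensor smul (f i) (y i))) \<longleftrightarrow>
         (\<forall>i j. i \<noteq> j \<longrightarrow> emeasure M (supp M (f i) \<inter> supp M (f j)) = 0)"
proof -
  interpret banach_space_over smul by fact
  let ?g = "\<lambda>i. tensor smul (f i) (y i)"
  have u: "strongly_measurable M u"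
    using assms(5) by (simp add: bochner_integrable_def)
  have g: "strongly_measurable M (?g i)" for i
    using bochner_integrable_tensor[OF assms(3)] by (simp add: bochner_integrable_def)
  have fin: "L1_norm M (?g i) < \<infinity>" for i
    using assms(3)[of i] unfolding L1_norm_tensor[OF assms(3)]
    by (simp add: L1_norm_def integrable_iff_bounded ennreal_mult_less_top)
  have supp_iff: "emeasure M (supp M (f i) \<inter> supp M (f j)) = 0 \<longleftrightarrow> (AE \<omega> in M. f i \<omega> = 0 \<or> f j \<omega> = 0)"
    for i j
    using assms(3) by (intro emeasure_supp_inter_eq_0_iff) auto
  show ?thesis
  proof (intro iffI allI impI)
    fix i j :: nat
    assume eq: "L1_norm M u = (\<Sum>i. L1_norm M (?g i))" and ij: "i \<noteq> j"
    have nc: "\<not> colinear smul (y i) (y j)"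
      using assms(4) ij by blast
    have "AE \<omega> in M. norm (?g i \<omega> + ?g j \<omega>) = norm (?g i \<omega>) + norm (?g j \<omega>)"
      by (rule L1_norm_sums_eq_imp_norm_add_eq[OF u g assms(6) fin eq ij])
    then have "AE \<omega> in M. f i \<omega> = 0 \<or> f j \<omega> = 0"
    proof eventually_elim
      case (elim \<omega>)
      then show ?case
        using smul_norm_add_eq_imp_colinear[OF assms(2)] not_colinear_nonzero[OF nc] nc
        unfolding tensor_def by blast
    qed
    then show "emeasure M (supp M (f i) \<inter> supp M (f j)) = 0"
      unfolding supp_iff .
  next
    assume "\<forall>i j. i \<noteq> j \<longrightarrow> emeasure M (supp M (f i) \<inter> supp M (f j)) = 0"
    \<comment> \<open>There are countably many pairs of indices, so one null set serves for all of
      them.\<close>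
    then have "AE \<omega> in M. \<forall>i j. i \<noteq> j \<longrightarrow> f i \<omega> = 0 \<or> f j \<omega> = 0"
      unfolding supp_iff AE_all_countable by auto
    then have "AE \<omega> in M. \<forall>i j. i \<noteq> j \<longrightarrow> ?g i \<omega> = 0 \<or> ?g j \<omega> = 0"
      by eventually_elim (auto simp: tensor_def)
    then show "L1_norm M u = (\<Sum>i. L1_norm M (?g i))"
      by (rule L1_norm_sums_eq_if_disjoint[OF u g assms(6)])
  qed
qed

end
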